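(* Let $\Lambda\subset\mathbb R^n$ be a full-rank lattice and let $K\subset\mathbb R^n$ be a minimal covering body with respect to $\Lambda$. If $\mathbf v$ is a vertex of $K$, $\mathbf z\in\Lambda\setminus\{\mathbf 0\}$, and $t>1$ is a real number, then the segment $[\mathbf v,\mathbf v+t\mathbf z]$ is not contained in the boundary $\operatorname{bd}K$.
   Context: A convex body in $\mathbb R^n$ is a compact convex set with nonempty interior. A convex body $K$ is a minimal covering body with respect to a full-rank lattice $\Lambda$ if $K+\Lambda=\mathbb R^n$ and no proper convex subbody $K'\subsetneq K$ (i.e. no convex body properly contained in $K$) satisfies $K'+\Lambda=\mathbb R^n$. Every minimal covering body is a polytope, and "vertex" means vertex of this polytope. *)

theory Defs
  imports "HOL-Analysis.Analysis" "HOL-Library.Set_Algebras"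
begin

text \<open>The set \<open>B\<close> is automatically finite, since it is independent in a
  finite-dimensional space.\<close>

definition full_rank_lattice :: "(real ^ 'n) set \<Rightarrow> bool" where
  "full_rank_lattice \<Lambda> \<longleftrightarrow>
     (\<exists>B. independent B \<and> span B = UNIV \<and>
          \<Lambda> = {v. \<exists>c :: real ^ 'n \<Rightarrow> int. v = (\<Sum>b\<in>B. real_of_int (c b) *\<^sub>R b)})"

definition convex_body :: "(real ^ 'n) set \<Rightarrow> bool" where
  "convex_body K \<longleftrightarrow> compact K \<and> convex K \<and> interior K \<noteq> {}"

text \<open>Here \<open>K + \<Lambda>\<close> is the Minkowski sum of sets.\<close>

definition minimal_covering_body :: "(real ^ 'n) set \<Rightarrow> (real ^ 'n) set \<Rightarrow> bool" where
  "minimal_covering_body \<Lambda> K \<longleftrightarrow>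
     convex_body K \<and> K + \<Lambda> = UNIV \<and>
     \<not> (\<exists>K'. convex_body K' \<and> K' \<subset> K \<and> K' + \<Lambda> = UNIV)"

end

theory Submission
  imports Defs
begin

text \<open>
  Since the boundary of \<open>K\<close> belongs to \<open>K\<close>, it suffices to see that a minimal covering body with
  extreme point \<open>v\<close> cannot contain \<open>v + t z\<close>. Suppose it does, and put \<open>\<mu> = 1 - 1/t > 0\<close>. Convexity gives
  \<open>v + \<mu> (y - v) + z = \<mu> y + (1 - \<mu>) (v + t z) \<in> K\<close> for every \<open>y \<in> K\<close>,
  so the copy of \<open>K\<close> shrunk by the factor \<open>\<mu>\<close> towards \<open>v\<close> lies in the translate \<open>K - z\<close>.

  Locally at \<open>v\<close> this makes \<open>K\<close> itself dispensable in the covering. Only finitely many lattice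
  translates of \<open>K\<close> come near \<open>v\<close>, so some ball about \<open>v\<close> is covered by those translates that
  contain \<open>v\<close> (lemma \<open>covering_near_point\<close>). Shrinking towards \<open>v\<close> maps each of these translates into
  itself, and maps \<open>K\<close> into \<open>K - z\<close>; hence the shrunken ball is covered by translates of \<open>K\<close> by
  nonzero lattice vectors (lemma \<open>covering_near_point_nonzero\<close>). For a polytope
  one would say that the tangent cone at \<open>v\<close> is contained in the one at \<open>v + z\<close>; the homothety
  expresses the same for arbitrary convex bodies.

  As \<open>v\<close> is extreme, the convex hull of \<open>K\<close> without a small ball about \<open>v\<close> is a
  smaller convex body. The points lost lie near \<open>v\<close>, and a nonzero lattice vector moves
  each of them to a point of \<open>K\<close> far from \<open>v\<close>, which was kept (lemma
  \<open>not_minimal_if_covered_by_nonzero\<close>). So the smaller body still covers.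
\<close>

section \<open>Lattices\<close>

lemma full_rank_lattice_diff:
  fixes \<Lambda> :: "(real ^ 'n) set"
  assumes "full_rank_lattice \<Lambda>" "a \<in> \<Lambda>" "b \<in> \<Lambda>"
  shows "a - b \<in> \<Lambda>"
proof -
  obtain B where L: "\<Lambda> = {v. \<exists>c :: real ^ 'n \<Rightarrow> int. v = (\<Sum>b\<in>B. real_of_int (c b) *\<^sub>R b)}"
    using assms(1) unfolding full_rank_lattice_def by blast
  obtain c d :: "real ^ 'n \<Rightarrow> int" where
    "a = (\<Sum>b\<in>B. real_of_int (c b) *\<^sub>R b)" "b = (\<Sum>b\<in>B. real_of_int (d b) *\<^sub>R b)"
    using assms(2,3) L by blast
  then have "a - b = (\<Sum>x\<in>B. real_of_int (c x - d x) *\<^sub>R x)"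
    by (simp add: sum_subtractf scaleR_left_diff_distrib)
  then show ?thesis
    unfolding L by (intro CollectI exI[of _ "\<lambda>x. c x - d x"])
qed

lemma full_rank_lattice_uminus:
  assumes "full_rank_lattice \<Lambda>" "a \<in> \<Lambda>"
  shows "- a \<in> \<Lambda>"
proof -
  have "(a - a) - a \<in> \<Lambda>"
    using assms full_rank_lattice_diff by blast
  then show ?thesis by simp
qed

text \<open>The coordinate functionals of a lattice basis are continuous and integer valued on the
  lattice, so a bounded set leaves only finitely many choices for each coordinate.\<close>

lemma finite_full_rank_lattice_Int_bounded:
  fixes \<Lambda> S :: "(real ^ 'n) set"
  assumes "full_rank_lattice \<Lambda>" "bounded S"
  shows "finite (\<Lambda> \<inter> S)"
proof -
  obtain B where ind: "independent B"
    and L: "\<Lambda> = {v. \<exists>c :: real ^ 'n \<Rightarrow> int. v = (\<Sum>b\<in>B. real_of_int (c b) *\<^sub>R b)}"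
    using assms(1) unfolding full_rank_lattice_def by blast
  have finB: "finite B"
    using ind by (rule independent_imp_finite)
  have "\<exists>g :: real ^ 'n \<Rightarrow> real. linear g \<and> (\<forall>x\<in>B. g x = (if x = b then 1 else 0))" for b
    using linear_independent_extend[OF ind, of "\<lambda>x. if x = b then 1 else (0::real)"] by blast
  then obtain g :: "real ^ 'n \<Rightarrow> real ^ 'n \<Rightarrow> real" where lin: "\<And>b. linear (g b)"
    and dual: "\<And>b x. x \<in> B \<Longrightarrow> g b x = (if x = b then 1 else 0)"
    by metis
  have coord: "g b (\<Sum>x\<in>B. real_of_int (c x) *\<^sub>R x) = real_of_int (c b)" if "b \<in> B" for b c
  proof -
    have "g b (\<Sum>x\<in>B. real_of_int (c x) *\<^sub>R x) = (\<Sum>x\<in>B. real_of_int (c x) *\<^sub>R g b x)"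
      by (simp add: linear_sum[OF lin] linear_scale[OF lin])
    also have "\<dots> = (\<Sum>x\<in>B. if x = b then real_of_int (c x) else 0)"
      by (intro sum.cong refl) (simp add: dual)
    finally show ?thesis
      using that finB by simp
  qed
  have fin_coords: "finite {k :: int. real_of_int k \<in> g b ` S}" for b
  proof -
    have "bounded (g b ` S)"
      using assms(2) lin by (simp add: bounded_linear_image linear_linear)
    then obtain M where M: "\<And>x. x \<in> g b ` S \<Longrightarrow> \<bar>x\<bar> \<le> M"
      unfolding bounded_iff real_norm_def by blast
    have "{k :: int. real_of_int k \<in> g b ` S} \<subseteq> {-\<lceil>M\<rceil>..\<lceil>M\<rceil>}"
    proof
      fix k :: int assume "k \<in> {k. real_of_int k \<in> g b ` S}"
      then have "\<bar>real_of_int k\<bar> \<le> M"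
        using M by blast
      then show "k \<in> {-\<lceil>M\<rceil>..\<lceil>M\<rceil>}"
        unfolding atLeastAtMost_iff by linarith
    qed
    then show ?thesis
      by (rule finite_subset) simp
  qed
  have "\<Lambda> \<inter> S \<subseteq> (\<lambda>c. \<Sum>b\<in>B. real_of_int (c b) *\<^sub>R b) `
    (PiE B (\<lambda>b. {k. real_of_int k \<in> g b ` S}))"
  proof
    fix v assume v: "v \<in> \<Lambda> \<inter> S"
    then obtain c :: "real ^ 'n \<Rightarrow> int" where c: "v = (\<Sum>b\<in>B. real_of_int (c b) *\<^sub>R b)"
      unfolding L by blast
    have "restrict c B \<in> PiE B (\<lambda>b. {k. real_of_int k \<in> g b ` S})"
    proof (rule restrict_PiE_iff[THEN iffD2], intro ballI CollectI)
      fix b assume "b \<in> B"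
      then show "real_of_int (c b) \<in> g b ` S"
        using coord[of b c] v unfolding c[symmetric] by (intro image_eqI[of _ _ v]) auto
    qed
    moreover have "v = (\<Sum>b\<in>B. real_of_int (restrict c B b) *\<^sub>R b)"
      unfolding c by (intro sum.cong refl) simp
    ultimately show "v \<in> (\<lambda>c. \<Sum>b\<in>B. real_of_int (c b) *\<^sub>R b) `
      (PiE B (\<lambda>b. {k. real_of_int k \<in> g b ` S}))"
      by (rule image_eqI[of _ _ "restrict c B", rotated])
  qed
  then show ?thesis
    by (rule finite_subset) (intro finite_imageI finite_PiE finB fin_coords)
qed

lemma full_rank_lattice_min_norm:
  fixes \<Lambda> :: "(real ^ 'n) set"
  assumes "full_rank_lattice \<Lambda>"
  obtains d where "d > 0" "\<And>w. w \<in> \<Lambda> \<Longrightarrow> w \<noteq> 0 \<Longrightarrow> d \<le> norm w"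
proof -
  have "finite (\<Lambda> \<inter> ball 0 1)"
    by (intro finite_full_rank_lattice_Int_bounded assms) simp
  then obtain d where d: "d > 0" "\<And>w. w \<in> \<Lambda> \<inter> ball 0 1 \<Longrightarrow> w \<noteq> 0 \<Longrightarrow> d \<le> dist 0 w"
    using finite_set_avoid[of "\<Lambda> \<inter> ball 0 1" 0] by metis
  show thesis
  proof (rule that[of "min d 1"])
    fix w assume "w \<in> \<Lambda>" "w \<noteq> 0"
    then show "min d 1 \<le> norm w"
      using d(2)[of w] by (cases "norm w < 1") auto
  qed (use d(1) in auto)
qed

section \<open>Coverings near a point\<close>

text \<open>The translates that meet the unit ball about \<open>v\<close> are finite in number; those among them
  that miss \<open>v\<close> form a closed set, which therefore keeps a positive distance from \<open>v\<close>.\<close>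

lemma covering_near_point:
  fixes \<Lambda> K :: "(real ^ 'n) set"
  assumes lat: "full_rank_lattice \<Lambda>" and "compact K" and cov: "K + \<Lambda> = UNIV"
  obtains r where "r > 0"
    "\<And>y. y \<in> ball v r \<Longrightarrow> \<exists>w\<in>\<Lambda>. y + w \<in> K \<and> v + w \<in> K"
proof -
  define F where "F = \<Lambda> \<inter> (\<lambda>(k, y). k - y) ` (K \<times> ball v 1)"
  define C where "C = (\<Union>w\<in>{w \<in> F. v + w \<notin> K}. (+) (- w) ` K)"
  have "finite F"
    unfolding F_def
    by (intro finite_full_rank_lattice_Int_bounded[OF lat] bounded_minus
        compact_imp_bounded[OF \<open>compact K\<close>] bounded_ball)
  then have "closed C"
    unfolding C_def
    by (intro closed_UN ballI closed_translation compact_imp_closed[OF \<open>compact K\<close>]) simp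
  moreover have "v \<notin> C"
    unfolding C_def by (auto simp: algebra_simps)
  ultimately obtain e where e: "e > 0" "ball v e \<subseteq> - C"
    using open_contains_ball[of "- C"] by auto
  show thesis
  proof (rule that[of "min e 1"])
    fix y assume y: "y \<in> ball v (min e 1)"
    obtain k u where ku: "k \<in> K" "u \<in> \<Lambda>" "y = k + u"
      using cov by (metis UNIV_I set_plus_elim)
    define w where "w = - u"
    have w: "w \<in> \<Lambda>" "y + w \<in> K"
      using ku full_rank_lattice_uminus[OF lat] by (simp_all add: w_def)
    then have "w \<in> F"
      unfolding F_def using y by (auto intro!: image_eqI[of _ _ "(y + w, y)"])
    moreover have "y \<in> (+) (- w) ` K"
      using w(2) by (intro image_eqI[of _ _ "y + w"]) auto
    ultimately have "v + w \<in> K"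
      using y e(2) unfolding C_def by (auto simp: subset_iff)
    then show "\<exists>w\<in>\<Lambda>. y + w \<in> K \<and> v + w \<in> K"
      using w by blast
  qed (use e(1) in auto)
qed

text \<open>A point \<open>x\<close> near \<open>v\<close> is pulled away from \<open>v\<close> to \<open>y = v + (x - v) / \<mu>\<close>. Whatever translate
  covers \<open>y\<close> and \<open>v\<close> also covers \<open>x\<close>, which lies between them, and if that translate is \<open>K\<close>
  itself then \<open>x\<close> lies in \<open>K - z\<close>.\<close>

lemma covering_near_point_nonzero:
  fixes \<Lambda> K :: "(real ^ 'n) set"
  assumes lat: "full_rank_lattice \<Lambda>" and "compact K" and conv: "convex K"
    and cov: "K + \<Lambda> = UNIV"
    and z: "z \<in> \<Lambda>" "z \<noteq> 0" and t: "t > 1" and vt: "v + t *\<^sub>R z \<in> K"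
  obtains r where "r > 0"
    "\<And>x. x \<in> ball v r \<Longrightarrow> \<exists>w\<in>\<Lambda>. w \<noteq> 0 \<and> x + w \<in> K"
proof -
  obtain r where r: "r > 0"
    "\<And>y. y \<in> ball v r \<Longrightarrow> \<exists>w\<in>\<Lambda>. y + w \<in> K \<and> v + w \<in> K"
    using covering_near_point[OF lat \<open>compact K\<close> cov] by metis
  define \<mu> where "\<mu> = 1 - 1 / t"
  have \<mu>: "0 < \<mu>" "\<mu> < 1" "(1 - \<mu>) * t = 1"
    using t by (simp_all add: \<mu>_def)
  show thesis
  proof (rule that[of "\<mu> * r"])
    fix x assume x: "x \<in> ball v (\<mu> * r)"
    define y where "y = v + (1 / \<mu>) *\<^sub>R (x - v)"
    have x_eq: "x = \<mu> *\<^sub>R y + (1 - \<mu>) *\<^sub>R v"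
      using \<mu>(1) by (simp add: y_def algebra_simps)
    have "dist v y = dist v x / \<mu>"
      using \<mu>(1) by (simp add: y_def dist_norm norm_minus_commute)
    also have "\<dots> < r"
      using x \<mu>(1) by (simp add: field_simps)
    finally have "y \<in> ball v r" by simp
    then obtain w where w: "w \<in> \<Lambda>" "y + w \<in> K" "v + w \<in> K"
      using r(2) by blast
    show "\<exists>w\<in>\<Lambda>. w \<noteq> 0 \<and> x + w \<in> K"
    proof (cases "w = 0")
      case False
      have "x + w = \<mu> *\<^sub>R (y + w) + (1 - \<mu>) *\<^sub>R (v + w)"
        by (simp add: x_eq algebra_simps)
      also have "\<dots> \<in> K"
        using w \<mu> by (intro convexD[OF conv]) auto
      finally show ?thesis
        using w(1) False by blast
    next
      case True
      have "x + z = \<mu> *\<^sub>R y + (1 - \<mu>) *\<^sub>R v + ((1 - \<mu>) * t) *\<^sub>R z"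
        by (simp add: x_eq \<mu>(3))
      also have "\<dots> = \<mu> *\<^sub>R y + (1 - \<mu>) *\<^sub>R (v + t *\<^sub>R z)"
        by (simp add: scaleR_add_right)
      also have "\<dots> \<in> K"
        using w(2) True vt \<mu> by (intro convexD[OF conv]) auto
      finally show ?thesis
        using z by blast
    qed
  qed (use r(1) \<mu>(1) in auto)
qed

section \<open>Cutting off an extreme point\<close>

text \<open>For an extreme point \<open>v\<close>, any hull of points of \<open>K\<close> other than \<open>v\<close> avoids \<open>v\<close>.
  Removing a small ball about \<open>v\<close> is thus a genuine loss, but it only removes points
  close to \<open>v\<close>.\<close>

lemma extreme_point_cut_off:
  fixes K :: "(real ^ 'n) set"
  assumes K: "convex_body K" and v: "v extreme_point_of K" and "\<rho> > 0"
  obtains K' where "convex_body K'" "K' \<subset> K" "K - ball v \<rho> \<subseteq> K'"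
proof -
  have cK: "compact K" "convex K" "interior K \<noteq> {}"
    using K by (auto simp: convex_body_def)
  have "v \<notin> interior K"
    using extreme_point_not_in_interior[OF v] .
  then obtain p where p: "p \<in> interior K" "p \<noteq> v"
    using cK(3) by auto
  define \<epsilon> where "\<epsilon> = min \<rho> (dist v p / 2)"
  \<comment> \<open>the radius is small enough to leave the interior point \<open>p\<close> outside the closed ball\<close>
  have \<epsilon>: "0 < \<epsilon>" "\<epsilon> \<le> \<rho>" "\<epsilon> < dist v p"
    using \<open>\<rho> > 0\<close> p(2) by (auto simp: \<epsilon>_def min_def)
  define K' where "K' = convex hull (K - ball v \<epsilon>)"
  have sub: "K' \<subseteq> K"
    unfolding K'_def using cK(2) by (intro hull_minimal) auto
  have "v \<notin> K'"
  proof
    assume "v \<in> K'"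
    with v sub have "v extreme_point_of K'"
      unfolding extreme_point_of_def by blast
    then have "v \<in> K - ball v \<epsilon>"
      unfolding K'_def by (rule extreme_point_of_convex_hull)
    then show False using \<epsilon>(1) by simp
  qed
  moreover have "v \<in> K"
    using v by (simp add: extreme_point_of_def)
  ultimately have "K' \<subset> K"
    using sub by blast
  moreover have "convex_body K'"
    unfolding convex_body_def
  proof (intro conjI)
    show "compact K'"
      unfolding K'_def by (intro compact_convex_hull compact_diff cK(1) open_ball)
    show "convex K'"
      unfolding K'_def by (rule convex_convex_hull)
    have "interior K - cball v \<epsilon> \<subseteq> K'"
      unfolding K'_def using interior_subset[of K] ball_subset_cball[of v \<epsilon>]
      by (intro order_trans[OF _ hull_subset]) blast
    then have "interior K - cball v \<epsilon> \<subseteq> interior K'"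
      by (intro interior_maximal open_Diff) auto
    moreover have "p \<in> interior K - cball v \<epsilon>"
      using p(1) \<epsilon>(3) by simp
    ultimately show "interior K' \<noteq> {}" by blast
  qed
  moreover have "K - ball v \<rho> \<subseteq> K'"
    unfolding K'_def using \<epsilon>(2) by (intro order_trans[OF _ hull_subset]) auto
  ultimately show thesis
    using that by blast
qed

text \<open>Let \<open>d\<close> be the minimal norm of a nonzero lattice vector. Translating a point within \<open>d/2\<close>
  of \<open>v\<close> by such a vector brings it to a distance at least \<open>d/2\<close> from \<open>v\<close>, outside the part of
  \<open>K\<close> that was cut off.\<close>

lemma not_minimal_if_covered_by_nonzero:
  fixes \<Lambda> K :: "(real ^ 'n) set"
  assumes lat: "full_rank_lattice \<Lambda>" and K: "convex_body K" and cov: "K + \<Lambda> = UNIV"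
    and v: "v extreme_point_of K" and "r > 0"
    and near: "\<And>x. x \<in> ball v r \<Longrightarrow> \<exists>w\<in>\<Lambda>. w \<noteq> 0 \<and> x + w \<in> K"
  shows "\<not> minimal_covering_body \<Lambda> K"
proof -
  obtain d where d: "d > 0" "\<And>w. w \<in> \<Lambda> \<Longrightarrow> w \<noteq> 0 \<Longrightarrow> d \<le> norm w"
    using full_rank_lattice_min_norm[OF lat] by metis
  define \<rho> where "\<rho> = min r (d / 2)"
  have \<rho>: "\<rho> > 0" "\<rho> \<le> r" "2 * \<rho> \<le> d"
    using \<open>r > 0\<close> d(1) by (auto simp: \<rho>_def)
  obtain K' where K': "convex_body K'" "K' \<subset> K" "K - ball v \<rho> \<subseteq> K'"
    using extreme_point_cut_off[OF K v \<rho>(1)] .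
  have "x \<in> K' + \<Lambda>" for x
  proof -
    obtain k u where ku: "k \<in> K" "u \<in> \<Lambda>" "x = k + u"
      using cov by (metis UNIV_I set_plus_elim)
    show ?thesis
    proof (cases "k \<in> ball v \<rho>")
      case False
      then have "k \<in> K'"
        using K'(3) ku(1) by blast
      then show ?thesis
        unfolding ku(3) using ku(2) by (rule set_plus_intro)
    next
      case True
      then have "k \<in> ball v r"
        using \<rho>(2) by simp
      then obtain w where w: "w \<in> \<Lambda>" "w \<noteq> 0" "k + w \<in> K"
        using near by blast
      have "norm w \<le> dist v k + dist v (k + w)"
        using dist_triangle[of k "k + w" v] by (simp add: dist_norm norm_minus_commute)
      then have "k + w \<notin> ball v \<rho>"
        using True d(2)[OF w(1,2)] \<rho>(3) by simp
      then have "k + w \<in> K'"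
        using K'(3) w(3) by blast
      moreover have "u - w \<in> \<Lambda>"
        using full_rank_lattice_diff[OF lat ku(2) w(1)] .
      ultimately have "(k + w) + (u - w) \<in> K' + \<Lambda>"
        by (rule set_plus_intro)
      then show ?thesis
        by (simp add: ku(3))
    qed
  qed
  then have "K' + \<Lambda> = UNIV" by blast
  then show ?thesis
    using K' unfolding minimal_covering_body_def by blast
qed

section \<open>Segments from a vertex in a lattice direction\<close>

theorem proposition3p9:
  fixes \<Lambda> K :: "(real ^ 'n) set" and v z :: "real ^ 'n" and t :: real
  assumes "full_rank_lattice \<Lambda>"
    and "minimal_covering_body \<Lambda> K"
    and "v extreme_point_of K"
    and "z \<in> \<Lambda> - {0}"
    and "t > 1"
  shows "\<not> closed_segment v (v + t *\<^sub>R z) \<subseteq> frontier K"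
proof
  assume seg: "closed_segment v (v + t *\<^sub>R z) \<subseteq> frontier K"
  have K: "convex_body K" "compact K" "convex K" "K + \<Lambda> = UNIV"
    using assms(2) by (auto simp: minimal_covering_body_def convex_body_def)
  have "v + t *\<^sub>R z \<in> frontier K"
    using seg by auto
  then have "v + t *\<^sub>R z \<in> K"
    using frontier_subset_closed[OF compact_imp_closed[OF K(2)]] by blast
  then obtain r where "r > 0" "\<And>x. x \<in> ball v r \<Longrightarrow> \<exists>w\<in>\<Lambda>. w \<noteq> 0 \<and> x + w \<in> K"
    using covering_near_point_nonzero[OF assms(1) K(2-4) _ _ assms(5)] assms(4)
    by (metis DiffE singletonI)
  then show False
    using not_minimal_if_covered_by_nonzero[OF assms(1) K(1) K(4) assms(3)] assms(2)
    by blast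
qed

end
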